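(* Let $r \geq 3$ be an integer. For every $n \geq 2$, every $r$-bisection closed family $\mathcal{F} \subset \mathcal{P}([n])$ satisfies \[ |\mathcal{F}| \leq \left\lfloor \tfrac{3n}{2} \right\rfloor - 2. \] Moreover: \begin{enumerate} \item (Tightness) For each $n \geq 2$, the family $\mathcal{F}_{\max}$ defined in the context is an $r$-bisection closed family over $[n]$ attaining this bound. \item (Uniqueness) For any $r$-bisection closed family $\mathcal{F}$ over $[n]$ attaining this bound, there is a permutation $\sigma$ of $[n]$ such that $\mathcal{F}_{\max} = \sigma(\mathcal{F}) := \{\sigma(A) : A \in \mathcal{F}\}$, where $\sigma(E) := \{\sigma(x) : x \in E\}$. \item (Robustness) There exists an absolute constant $C > 0$ such that the following holds: if $\mathcal{F}$ is an $r$-bisection closed family over $[n]$ with $|\mathcal{F}| \geq (\frac{3}{2} - \epsilon)n$ for some $0 < \epsilon < 0.1$, then for some permutation $\sigma$ of $[n]$, $|\sigma(\mathcal{F}) \setminus \mathcal{F}_{\max}| < C\epsilon n$. \end{enumerate}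
   Context: $[n] = \{1,\dots,n\}$. For an integer $r \geq 2$, a family $\mathcal{F} \subset \mathcal{P}([n])$ is $r$-bisection closed if for each $2 \leq t \leq r$ and any $t$ distinct sets $A_1,\dots,A_t \in \mathcal{F}$ we have $|A_1 \cap \dots \cap A_t| \in \{\tfrac12|A_1|, \dots, \tfrac12|A_t|\}$. The family $\mathcal{F}_{\max} \subset \mathcal{P}([n])$ is defined as follows: writing $x_1\cdots x_\ell$ for the set $\{x_1,\dots,x_\ell\}$, for $n$ even, $\mathcal{F}_{\max} = \{12, 13, \dots, 1n, 1234, 1256, \dots, 12(n-1)n\}$, and for $n$ odd, $\mathcal{F}_{\max} = \{12, 13, \dots, 1n, 1234, 1256, \dots, 12(n-2)(n-1)\}$. That is, $\mathcal{F}_{\max}$ consists of all sets $\{1,j\}$ with $2 \leq j \leq n$ together with the sets $\{1,2,2k+1,2k+2\}$ for $1 \leq k \leq \lfloor (n-2)/2 \rfloor$.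
   Formalization: Since the claim fails for degenerate members, the bound and uniqueness assume the empty set is not in F, and that F has no singletons when n ≤ 3 (bound) or n ≤ 5 (uniqueness); robustness assumes the empty set is not in F when n = 2. *)

theory Defs
  imports Complex_Main "HOL-Combinatorics.Permutations"
begin

text \<open>
  A choice of \<open>t\<close> distinct members of the family is a subfamily \<open>S\<close> with \<open>card S = t\<close>.
\<close>

definition bisection_closed :: "nat \<Rightarrow> 'a set set \<Rightarrow> bool" where
  "bisection_closed r F \<longleftrightarrow>
     (\<forall>t\<in>{2..r}. \<forall>S\<subseteq>F. card S = t \<longrightarrow>
        real (card (\<Inter>S)) \<in> (\<lambda>A. real (card A) / 2) ` S)"

definition F_max :: "nat \<Rightarrow> nat set set" where
  "F_max n = {{1, j} |j. 2 \<le> j \<and> j \<le> n} \<union>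
             {{1, 2, 2 * k + 1, 2 * k + 2} |k. 1 \<le> k \<and> k \<le> (n - 2) div 2}"

definition family_image :: "('a \<Rightarrow> 'b) \<Rightarrow> 'a set set \<Rightarrow> 'b set set" where
  "family_image \<sigma> F = {\<sigma> ` A |A. A \<in> F}"

text \<open>
  The definition puts no restriction on the members of the family, so degenerate members are
  possible: the empty set can be added to every closed family, and a star of pairs can be extended
  by its centre.  The second construction yields \<open>n\<close> sets, which exceeds \<open>\<lfloor>3n/2\<rfloor> - 2\<close> for
  \<open>n \<le> 3\<close> and equals it for \<open>n \<in> {4, 5}\<close>.
\<close>

lemma bisection_closed_insert_empty:
  assumes "bisection_closed r F"
  shows "bisection_closed r (insert {} F)"
  unfolding bisection_closed_def
proof (intro ballI allI impI)
  fix t S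
  assume t: "t \<in> {2..r}" and S: "S \<subseteq> insert {} F" "card S = t"
  show "real (card (\<Inter>S)) \<in> (\<lambda>A. real (card A) / 2) ` S"
  proof (cases "{} \<in> S")
    case True
    then have "\<Inter>S = {}" by blast
    with True show ?thesis by (auto intro!: image_eqI[where x = "{}"])
  next
    case False
    with S have "S \<subseteq> F" by blast
    with assms t S show ?thesis unfolding bisection_closed_def by blast
  qed
qed

lemma bisection_closed_star_with_centre:
  "bisection_closed r (insert {1} {{1, j} |j. 2 \<le> j \<and> j \<le> (n::nat)})"
  unfolding bisection_closed_def
proof (intro ballI allI impI)
  fix t and S :: "nat set set"
  assume t: "t \<in> {2..r}" and S: "S \<subseteq> insert {1} {{1, j} |j. 2 \<le> j \<and> j \<le> n}" "card S = t"
  from t S have "card S \<ge> 2" by simp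
  then obtain A B where AB: "A \<in> S" "B \<in> S" "A \<noteq> B"
    by (metis card_2_iff' obtain_subset_with_card_n subset_iff)
  have one: "1 \<in> X" if "X \<in> S" for X using that S by auto
  obtain j where j: "{1, j} \<in> S" "2 \<le> j" using AB S by blast
  have "\<Inter>S \<subseteq> A \<inter> B" using AB by blast
  also have "A \<inter> B \<subseteq> {1}" using AB S by auto
  finally have "\<Inter>S = {1}" using one by blast
  with j show "real (card (\<Inter>S)) \<in> (\<lambda>A. real (card A) / 2) ` S"
    by (auto intro!: image_eqI[where x = "{1, j}"])
qed

end

theory Submission
  imports Defs
begin

text \<open>
  Only intersections of two and three members are used for the upper bounds.  Members of equal size
  \<open>2k\<close> form a sunflower with kernel of size \<open>k\<close>, and every member \<open>A\<close> has a petal containing at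
  least half of its points that is disjoint from all members of size greater than \<open>2|A|\<close>.  Hence the
  petals through a given point belong to sets of distinct sizes within a factor of two, and if all
  sizes are at least \<open>2k\<close>, weighing each set by its petal bounds their number by
  \<open>1/k + \<dots> + 1/(2k)\<close> per point.

  If there are at least two pairs, they all share a point \<open>c\<close>, which then lies in every member.  The
  members that are neither pairs nor 4-sets avoid the other ends of the pairs, so by the weight bound
  with \<open>k = 3\<close> there are at most \<open>19/20\<close> of them per point not covered by a pair.  Adding the pairs
  and the at most \<open>(n - 2) / 2\<close> 4-sets gives the bound, and the defect controls the distance from
  \<open>F_max\<close>.  If there is at most one pair, the weight bound with \<open>k = 2\<close>, at most \<open>13/12\<close> per
  point, is already too small.
\<close>

section \<open>Harmonic weights and the petal bound\<close>

lemma card_2_obtain_other: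
  assumes "card S = 2" "c \<in> S"
  obtains y where "y \<noteq> c" "S = {c, y}"
proof -
  obtain a b where "S = {a, b}" "a \<noteq> b" using assms(1) by (auto simp: card_2_iff)
  then show ?thesis using assms(2) that[of a] that[of b] by blast
qed

text \<open>The index \<open>j\<close> is half a size: a set with \<open>2 * j\<close> points puts
  weight \<open>1 / j\<close> on each point of its petal, and the sets whose petals share a point
  have distinct half-sizes between \<open>a\<close> and \<open>2 * a\<close> for some
  \<open>a \<ge> k\<close>.\<close>

definition petal_weight :: "nat \<Rightarrow> real" where
  "petal_weight k = (\<Sum>j=k..2*k. 1 / real j)"

lemma petal_weight_2: "petal_weight 2 = 13/12"
  by (simp add: petal_weight_def numeral_eq_Suc sum.atLeast_Suc_atMost field_simps)

lemma petal_weight_3: "petal_weight 3 = 19/20"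
  by (simp add: petal_weight_def numeral_eq_Suc sum.atLeast_Suc_atMost field_simps)

text \<open>Passing from \<open>k\<close> to \<open>k + 1\<close> drops the term
  \<open>1 / k\<close> and appends \<open>1 / (2*k+1)\<close> and \<open>1 / (2*k+2)\<close>, each
  at most half of it.\<close>

lemma petal_weight_Suc_le:
  assumes "k \<ge> 1"
  shows "petal_weight (Suc k) \<le> petal_weight k"
proof -
  have "petal_weight k = 1 / real k + (\<Sum>j=Suc k..2*k. 1 / real j)"
    unfolding petal_weight_def by (subst sum.atLeast_Suc_atMost) auto
  moreover have "petal_weight (Suc k) =
      (\<Sum>j=Suc k..2*k. 1 / real j) + 1 / real (2*k+1) + 1 / real (2*k+2)"
    using assms unfolding petal_weight_def by simp
  moreover have "1 / real (2*k+1) + 1 / real (2*k+2) \<le> 1 / real (2*k) + 1 / real (2*k)"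
    using assms by (intro add_mono divide_left_mono) auto
  moreover have "1 / real (2*k) + 1 / real (2*k) = 1 / real k"
    using assms by (simp add: field_simps)
  ultimately show ?thesis by linarith
qed

lemma petal_weight_antimono:
  assumes "1 \<le> k" "k \<le> a"
  shows "petal_weight a \<le> petal_weight k"
  using assms(2,1)
proof (induction a rule: dec_induct)
  case (step a)
  then show ?case using petal_weight_Suc_le[of a] by linarith
qed simp

text \<open>
  Spread the unit weight of each \<open>A\<close> evenly over its petal \<open>A - K A\<close>.  The sets whose petals meet
  in a given point have distinct sizes, all within a factor of two.
\<close>

lemma card_le_petal_weight:
  assumes "finite G" "finite Y" "k \<ge> 1"
    and fin: "\<And>A. A \<in> G \<Longrightarrow> finite A"
    and K: "\<And>A. A \<in> G \<Longrightarrow> K A \<subseteq> A" "\<And>A. A \<in> G \<Longrightarrow> 2 * card (K A) \<le> card A"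
    and even: "\<And>A. A \<in> G \<Longrightarrow> even (card A)"
    and large: "\<And>A. A \<in> G \<Longrightarrow> 2 * k \<le> card A"
    and disj: "\<And>A B. A \<in> G \<Longrightarrow> B \<in> G \<Longrightarrow> A \<noteq> B \<Longrightarrow>
                 card B = card A \<or> card B > 2 * card A \<Longrightarrow> A \<inter> B \<subseteq> K A"
    and Y: "\<And>A. A \<in> G \<Longrightarrow> A - K A \<subseteq> Y"
  shows "real (card G) \<le> petal_weight k * real (card Y)"
proof -
  define T where "T x = {A\<in>G. x \<in> A - K A}" for x
  have point: "(\<Sum>A\<in>T x. 2 / real (card A)) \<le> petal_weight k" for x
  proof (cases "T x = {}")
    case True
    then show ?thesis by (simp add: petal_weight_def sum_nonneg)
  next
    case False
    have finT: "finite (T x)" using \<open>finite G\<close> by (simp add: T_def)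
    define h where "h A = card A div 2" for A :: "'a set"
    have h: "2 * h A = card A" if "A \<in> T x" for A
      using that even by (auto simp: h_def T_def)
    have inj: "inj_on h (T x)"
    proof (rule inj_onI)
      fix A B assume AB: "A \<in> T x" "B \<in> T x" "h A = h B"
      then have "card B = card A" using h by metis
      then show "A = B" using AB disj[of A B] unfolding T_def by blast
    qed
    define a where "a = Min (h ` T x)"
    have "a \<in> h ` T x" unfolding a_def using finT False by (intro Min_in) auto
    then obtain A where A: "A \<in> T x" "h A = a" by blast
    have range: "h ` T x \<subseteq> {a..2*a}"
    proof
      fix j assume "j \<in> h ` T x"
      then obtain B where B: "B \<in> T x" "h B = j" by blast
      have "a \<le> j" unfolding a_def using finT B by (intro Min_le) auto
      \<comment> \<open>A set more than twice as large as the smallest one, \<open>A\<close>, meets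
        it only inside \<open>K A\<close>, whereas \<open>x\<close> lies outside
        \<open>K A\<close>.\<close>
      moreover have "\<not> card B > 2 * card A"
      proof
        assume "card B > 2 * card A"
        moreover from this have "A \<noteq> B" by auto
        ultimately show False using A B disj[of A B] unfolding T_def by blast
      qed
      ultimately show "j \<in> {a..2*a}" using h[OF A(1)] h[OF B(1)] A B by auto
    qed
    have "(\<Sum>A\<in>T x. 2 / real (card A)) = (\<Sum>A\<in>T x. 1 / real (h A))"
    proof (rule sum.cong)
      fix A assume "A \<in> T x"
      then have "real (card A) = 2 * real (h A)" using h[of A] by linarith
      then show "2 / real (card A) = 1 / real (h A)" by simp
    qed simp
    also have "\<dots> = (\<Sum>j\<in>h ` T x. 1 / real j)"
      using inj by (simp add: sum.reindex)
    also have "\<dots> \<le> petal_weight a"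
      unfolding petal_weight_def using range by (intro sum_mono2) auto
    also have "\<dots> \<le> petal_weight k"
    proof (rule petal_weight_antimono)
      have "A \<in> G" using A by (simp add: T_def)
      then show "k \<le> a" using large[of A] h[OF A(1)] A by simp
    qed fact
    finally show ?thesis .
  qed
  have "real (card G) = (\<Sum>A\<in>G. 1)" by simp
  \<comment> \<open>The petal holds at least half of the points of \<open>A\<close>, so it collects
    total weight at least 1.\<close>
  also have "\<dots> \<le> (\<Sum>A\<in>G. \<Sum>x\<in>A - K A. 2 / real (card A))"
  proof (rule sum_mono)
    fix A assume A: "A \<in> G"
    have pos: "card A > 0" using large[OF A] \<open>k \<ge> 1\<close> by linarith
    have "card (A - K A) = card A - card (K A)"
      using A K(1) fin by (intro card_Diff_subset) (auto intro: finite_subset)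
    then have "2 * card (A - K A) \<ge> card A" using K(2)[OF A] by linarith
    then have "2 * real (card (A - K A)) \<ge> real (card A)" by linarith
    then show "1 \<le> (\<Sum>x\<in>A - K A. 2 / real (card A))"
      using pos by (simp add: field_simps)
  qed
  also have "\<dots> = (\<Sum>A\<in>G. \<Sum>x\<in>{x\<in>Y. x \<in> A - K A}. 2 / real (card A))"
    using Y by (intro sum.cong) auto
  also have "\<dots> = (\<Sum>x\<in>Y. \<Sum>A\<in>T x. 2 / real (card A))"
    unfolding T_def using assms(1,2) by (intro sum.swap_restrict)
  also have "\<dots> \<le> (\<Sum>x\<in>Y. petal_weight k)"
    using point by (intro sum_mono)
  finally show ?thesis by (simp add: mult.commute)
qed

section \<open>Families in which pairs and triples of members bisect\<close>

text \<open>The closure condition for \<open>t = 2\<close> and \<open>t = 3\<close>, doubled so that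
  everything stays in the natural numbers.\<close>

locale bisecting_family =
  fixes X :: "'a set" and F :: "'a set set"
  assumes finX: "finite X" and sub: "F \<subseteq> Pow X" and nonempty: "{} \<notin> F"
    and pair: "A \<in> F \<Longrightarrow> B \<in> F \<Longrightarrow> A \<noteq> B \<Longrightarrow> 2 * card (A \<inter> B) \<in> {card A, card B}"
    and triple: "A \<in> F \<Longrightarrow> B \<in> F \<Longrightarrow> C \<in> F \<Longrightarrow> A \<noteq> B \<Longrightarrow> A \<noteq> C \<Longrightarrow> B \<noteq> C \<Longrightarrow>
                   2 * card (A \<inter> B \<inter> C) \<in> {card A, card B, card C}"
begin

lemma finF: "finite F"
  using finX sub by (meson finite_Pow_iff finite_subset)

lemma fin_member: "A \<in> F \<Longrightarrow> finite A"
  using finX sub by (meson Pow_iff finite_subset in_mono)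

lemma card_pos: "A \<in> F \<Longrightarrow> card A > 0"
  using fin_member nonempty by (metis card_gt_0_iff)

lemma card_member_le: "A \<in> F \<Longrightarrow> card A \<le> card X"
  using finX sub by (meson Pow_iff card_mono in_mono)

text \<open>Twice the size of an intersection is even and equals one of the two sizes.\<close>

lemma odd_unique:
  assumes "A \<in> F" "B \<in> F" "odd (card A)" "odd (card B)"
  shows "A = B"
proof (rule ccontr)
  assume "A \<noteq> B"
  then have "even (card A) \<or> even (card B)"
    using pair[of A B] assms by (metis dvd_triv_left insert_iff singletonD)
  then show False using assms by simp
qed

text \<open>The intersection has at most \<open>card A\<close> points, so it cannot be half of a set
  with more than \<open>2 * card A\<close> points.\<close>

lemma inter_half:
  assumes "A \<in> F" "B \<in> F" "A \<noteq> B" "card B = card A \<or> card B > 2 * card A"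
  shows "2 * card (A \<inter> B) = card A"
proof -
  have "card (A \<inter> B) \<le> card A" using assms fin_member by (intro card_mono) auto
  then show ?thesis using pair[of A B] assms by auto
qed

text \<open>The triple intersection already has half the size of \<open>A\<close>, as do
  \<open>A \<inter> B\<close> and \<open>A \<inter> C\<close>. Both contain it, so all three sets
  coincide.\<close>

lemma triple_half:
  assumes "A \<in> F" "B \<in> F" "C \<in> F" "A \<noteq> B" "A \<noteq> C" "B \<noteq> C"
    "card B = card A \<or> card B > 2 * card A" "card C = card A \<or> card C > 2 * card A"
  shows "A \<inter> C = A \<inter> B"
proof -
  have f: "finite (A \<inter> B)" "finite (A \<inter> C)" using fin_member assms by auto
  have "card (A \<inter> B \<inter> C) \<le> card A" using assms fin_member by (intro card_mono) auto
  then have c: "2 * card (A \<inter> B \<inter> C) = card A"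
    using triple[of A B C] assms by auto
  have "A \<inter> B \<inter> C = A \<inter> B"
    using f c inter_half[of A B] assms by (intro card_subset_eq) auto
  moreover have "A \<inter> B \<inter> C = A \<inter> C"
    using f c inter_half[of A C] assms by (intro card_subset_eq) auto
  ultimately show ?thesis by simp
qed

text \<open>By \<open>triple_half\<close> the sets \<open>A \<inter> B\<close> agree for all
  eligible \<open>B\<close>, and this common set serves as \<open>K\<close>; without an eligible
  \<open>B\<close> the set \<open>Z\<close> itself does.\<close>

lemma exists_kernel:
  assumes "G \<subseteq> F" "A \<in> G" "\<And>B. B \<in> G \<Longrightarrow> Z \<subseteq> B" "2 * card Z \<le> card A"
  shows "\<exists>K. Z \<subseteq> K \<and> K \<subseteq> A \<and> 2 * card K \<le> card A \<and>
           (\<forall>B\<in>G. A \<noteq> B \<and> (card B = card A \<or> card B > 2 * card A) \<longrightarrow> A \<inter> B \<subseteq> K)"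
proof (cases "\<exists>B\<in>G. A \<noteq> B \<and> (card B = card A \<or> card B > 2 * card A)")
  case False
  then show ?thesis using assms by (intro exI[of _ Z]) auto
next
  case True
  then obtain B where B: "B \<in> G" "A \<noteq> B" "card B = card A \<or> card B > 2 * card A" by blast
  have "A \<inter> C \<subseteq> A \<inter> B" if "C \<in> G" "A \<noteq> C" "card C = card A \<or> card C > 2 * card A" for C
    using triple_half[of A B C] that B assms(1,2) by (cases "B = C") auto
  moreover have "2 * card (A \<inter> B) = card A" using B inter_half[of A B] assms(1,2) by blast
  moreover have "Z \<subseteq> A \<inter> B" using B assms(2,3) by blast
  ultimately show ?thesis by (intro exI[of _ "A \<inter> B"]) (simp add: le_infI1)
qed

text \<open>\<open>Z\<close> is a common part of the members, such as the centre of a star. Kernels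
  containing it keep the petals inside \<open>Y\<close>.\<close>

lemma even_card_le:
  assumes "G \<subseteq> F" "finite Y" "k \<ge> 1"
    and "\<And>A. A \<in> G \<Longrightarrow> even (card A)" "\<And>A. A \<in> G \<Longrightarrow> 2 * k \<le> card A"
    and "\<And>A. A \<in> G \<Longrightarrow> Z \<subseteq> A" "\<And>A. A \<in> G \<Longrightarrow> A \<subseteq> Y \<union> Z" "card Z \<le> k"
  shows "real (card G) \<le> petal_weight k * real (card Y)"
proof -
  have "\<exists>K. Z \<subseteq> K \<and> K \<subseteq> A \<and> 2 * card K \<le> card A \<and>
           (\<forall>B\<in>G. A \<noteq> B \<and> (card B = card A \<or> card B > 2 * card A) \<longrightarrow> A \<inter> B \<subseteq> K)"
    if "A \<in> G" for A
    using that assms(1,6,8) assms(5)[OF that] by (intro exists_kernel) auto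
  then obtain K where K: "Z \<subseteq> K A" "K A \<subseteq> A" "2 * card (K A) \<le> card A"
      "\<forall>B\<in>G. A \<noteq> B \<and> (card B = card A \<or> card B > 2 * card A) \<longrightarrow> A \<inter> B \<subseteq> K A"
      if "A \<in> G" for A
    by metis
  show ?thesis
  proof (rule card_le_petal_weight[where K = K])
    show "finite G" using assms(1) finF finite_subset by blast
    show "finite A" if "A \<in> G" for A using that assms(1) fin_member by blast
    show "A - K A \<subseteq> Y" if "A \<in> G" for A using K(1)[OF that] assms(7)[OF that] by blast
    show "A \<inter> B \<subseteq> K A" if "A \<in> G" "B \<in> G" "A \<noteq> B" "card B = card A \<or> card B > 2 * card A" for A B
      using K(4)[OF that(1)] that by blast
  qed (use assms K in auto)
qed

text \<open>An odd member \<open>D\<close> bisects every other member, so \<open>A - D\<close> can serve as the petal of \<open>A\<close>.\<close>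

lemma even_card_le_odd:
  assumes "G \<subseteq> F" "finite Y" "k \<ge> 1"
    and "\<And>A. A \<in> G \<Longrightarrow> even (card A)" "\<And>A. A \<in> G \<Longrightarrow> 2 * k \<le> card A"
    and "D \<in> F" "odd (card D)" "\<And>A. A \<in> G \<Longrightarrow> A - D \<subseteq> Y"
  shows "real (card G) \<le> petal_weight k * real (card Y)"
proof -
  have ne: "A \<noteq> D" if "A \<in> G" for A using that assms by auto
  have half: "2 * card (A \<inter> D) = card A" if "A \<in> G" for A
  proof -
    have "2 * card (A \<inter> D) \<noteq> card D" using assms(7) by (metis dvd_triv_left)
    then show ?thesis using pair[of A D] ne[OF that] that assms by auto
  qed
  show ?thesis
  proof (rule card_le_petal_weight[where K = "\<lambda>A. A \<inter> D"])
    show "finite G" using assms(1) finF finite_subset by blast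
    show "finite A" if "A \<in> G" for A using that assms(1) fin_member by blast
    show "A - A \<inter> D \<subseteq> Y" if "A \<in> G" for A using assms(8)[OF that] by blast
    show "A \<inter> B \<subseteq> A \<inter> D"
      if AB: "A \<in> G" "B \<in> G" "A \<noteq> B" "card B = card A \<or> card B > 2 * card A" for A B
    proof -
      have inF: "A \<in> F" "B \<in> F" using AB assms(1) by auto
      have "card (A \<inter> B \<inter> D) \<le> card A" using inF fin_member by (intro card_mono) auto
      moreover have "2 * card (A \<inter> B \<inter> D) \<noteq> card D" using assms(7) by (metis dvd_triv_left)
      ultimately have "2 * card (A \<inter> B \<inter> D) = card A"
        using triple[of A B D] inF AB ne[OF AB(1)] ne[OF AB(2)] assms(6) by auto
      \<comment> \<open>Both sides have half the size of \<open>A\<close>, which forces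
        \<open>A \<inter> B\<close> into \<open>D\<close>.\<close>
      then have "A \<inter> B \<inter> D = A \<inter> B"
        using inter_half[OF inF AB(3,4)] fin_member[OF inF(1)] by (intro card_subset_eq) auto
      then show ?thesis by blast
    qed
  qed (use assms half in auto)
qed

text \<open>At most one member \<open>D\<close> is odd, and it has at least two points in
  \<open>Y\<close>. With petals taken outside \<open>D\<close>, the even members have only
  \<open>card Y - 2\<close> points available; the saving \<open>2 * petal_weight k \<ge> 1\<close>
  pays for \<open>D\<close>.\<close>

lemma card_le:
  assumes "G \<subseteq> F" "finite Y" "k \<ge> 1" "petal_weight k \<ge> 1/2"
    and large: "\<And>A. A \<in> G \<Longrightarrow> odd (card A) \<or> 2 * k \<le> card A"
    and no1: "\<And>A. A \<in> G \<Longrightarrow> card A \<noteq> 1"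
    and Z: "\<And>A. A \<in> G \<Longrightarrow> Z \<subseteq> A" and Y: "\<And>A. A \<in> G \<Longrightarrow> A \<subseteq> Y \<union> Z" and "card Z \<le> 1"
  shows "real (card G) \<le> petal_weight k * real (card Y)"
proof (cases "\<exists>D\<in>G. odd (card D)")
  case False
  show ?thesis
  proof (rule even_card_le[where Z = Z])
    show "2 * k \<le> card A" if "A \<in> G" for A using large[OF that] False that by blast
    show "even (card A)" if "A \<in> G" for A using False that by blast
    show "card Z \<le> k" using assms(3,9) by linarith
  qed (fact assms)+
next
  case True
  then obtain D where D: "D \<in> G" "odd (card D)" by blast
  have DF: "D \<in> F" "finite D" using D assms(1) fin_member by auto
  have finG: "finite G" using assms(1) finF finite_subset by blast
  have "card D \<noteq> 1" using no1 D by blast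
  then have "card D \<ge> 3" using D(2) by presburger
  moreover have "card D \<le> card (D \<inter> Y) + card Z"
  proof -
    have "D = (D \<inter> Y) \<union> Z" using Y[OF D(1)] Z[OF D(1)] by blast
    then show ?thesis using card_Un_le by metis
  qed
  ultimately have "card (D \<inter> Y) \<ge> 2" using \<open>card Z \<le> 1\<close> by linarith
  moreover have "card (Y - D) = card Y - card (D \<inter> Y)"
    using \<open>finite Y\<close> by (metis Int_commute card_Diff_subset_Int finite_Int)
  moreover have "card (D \<inter> Y) \<le> card Y" using \<open>finite Y\<close> by (intro card_mono) auto
  ultimately have cY: "real (card (Y - D)) \<le> real (card Y) - 2" by linarith
  have evens: "even (card A)" if "A \<in> G - {D}" for A
    using that odd_unique[of A D] D DF assms(1) by auto
  have "real (card (G - {D})) \<le> petal_weight k * real (card (Y - D))"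
  proof (rule even_card_le_odd[of _ _ _ D])
    show "A - D \<subseteq> Y - D" if "A \<in> G - {D}" for A
      using Y[of A] Z[OF D(1)] that by blast
    show "2 * k \<le> card A" if "A \<in> G - {D}" for A using large[of A] evens[OF that] that by auto
  qed (use assms(1-3) evens D DF in auto)
  also have "\<dots> \<le> petal_weight k * (real (card Y) - 2)"
    using cY assms(4) by (intro mult_left_mono) auto
  also have "\<dots> \<le> petal_weight k * real (card Y) - 1"
    using assms(4) by (simp add: algebra_simps)
  finally show ?thesis using card.remove[OF finG D(1)] by simp
qed

section \<open>Layers of equal size, and families with few pairs\<close>

definition layer :: "nat \<Rightarrow> 'a set set" where
  "layer s = {A\<in>F. card A = s}"

text \<open>Members of \<open>F_max\<close> have 2 or 4 points, so these sets are never carried into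
  \<open>F_max\<close> by a permutation.\<close>

definition others :: "'a set set" where
  "others = {A\<in>F. card A \<notin> {2, 4}}"

lemma finite_layer: "finite (layer s)"
  using finF by (simp add: layer_def)

text \<open>One set is exchanged at a time by \<open>triple_half\<close>, passing through
  \<open>A' \<inter> A\<close>.\<close>

lemma layer_sunflower:
  assumes "A \<in> layer s" "B \<in> layer s" "A' \<in> layer s" "B' \<in> layer s" "A \<noteq> B" "A' \<noteq> B'"
  shows "A' \<inter> B' = A \<inter> B"
proof -
  have swap: "U \<inter> W = U \<inter> V"
    if "U \<in> layer s" "V \<in> layer s" "W \<in> layer s" "U \<noteq> V" "U \<noteq> W" for U V W
    using that triple_half[of U V W] by (cases "V = W") (auto simp: layer_def)
  show ?thesis
  proof (cases "A' = A")
    case True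
    then show ?thesis using swap assms by metis
  next
    case False
    then have "A' \<inter> B' = A' \<inter> A" using swap[of A' A B'] assms by blast
    also have "\<dots> = A \<inter> B" using swap[of A B A'] assms False by blast
    finally show ?thesis .
  qed
qed

text \<open>The kernel and the pairwise disjoint petals have \<open>k\<close> points each. A single
  member has \<open>2 * k\<close> points, which fits the same formula.\<close>

lemma layer_card_le:
  assumes "layer (2 * k) \<noteq> {}"
  shows "k * (card (layer (2 * k)) + 1) \<le> card X"
proof -
  obtain A where A: "A \<in> layer (2 * k)" using assms by blast
  then have AF: "A \<in> F" "card A = 2 * k" by (auto simp: layer_def)
  show ?thesis
  proof (cases "layer (2 * k) = {A}")
    case True
    then show ?thesis using AF card_member_le[of A] by simp
  next
    case False
    then obtain B where B: "B \<in> layer (2 * k)" "A \<noteq> B" using A by blast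
    then have BF: "B \<in> F" "card B = 2 * k" by (auto simp: layer_def)
    define K where "K = A \<inter> B"
    have K: "card K = k" using inter_half[of A B] AF BF B(2) by (simp add: K_def)
    have KX: "K \<subseteq> X" "finite K" using AF(1) sub finX by (auto simp: K_def intro: finite_subset)
    have meet: "C \<inter> D = K" if "C \<in> layer (2 * k)" "D \<in> layer (2 * k)" "C \<noteq> D" for C D
      using layer_sunflower[OF A B(1) that(1,2) B(2) that(3)] by (simp add: K_def)
    have KC: "K \<subseteq> C" if "C \<in> layer (2 * k)" for C
      using meet[OF that A] meet[OF that B(1)] B(2) by (cases "C = A") auto
    have petal: "card (C - K) = k" if "C \<in> layer (2 * k)" for C
      using card_Diff_subset[OF KX(2) KC[OF that]] K that by (simp add: layer_def)
    have "card (\<Union>C\<in>layer (2 * k). C - K) = (\<Sum>C\<in>layer (2 * k). card (C - K))"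
    proof (rule card_UN_disjoint)
      show "\<forall>C\<in>layer (2 * k). finite (C - K)" by (auto simp: layer_def fin_member)
      show "\<forall>C\<in>layer (2 * k). \<forall>D\<in>layer (2 * k). C \<noteq> D \<longrightarrow> (C - K) \<inter> (D - K) = {}"
        using meet by blast
    qed (rule finite_layer)
    also have "\<dots> = k * card (layer (2 * k))" using petal by simp
    finally have U: "card (\<Union>C\<in>layer (2 * k). C - K) = k * card (layer (2 * k))" .
    have UX: "(\<Union>C\<in>layer (2 * k). C - K) \<subseteq> X" using sub by (auto simp: layer_def)
    have "card ((\<Union>C\<in>layer (2 * k). C - K) \<union> K) = k * card (layer (2 * k)) + k"
      using U K KX(2) finite_subset[OF UX finX] by (subst card_Un_disjoint) auto
    moreover have "card ((\<Union>C\<in>layer (2 * k). C - K) \<union> K) \<le> card X"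
      using UX KX finX by (intro card_mono) auto
    ultimately show ?thesis by simp
  qed
qed

lemma card_odd_le_1: "card {A\<in>F. odd (card A)} \<le> 1"
  using odd_unique finF by (auto simp: card_le_Suc0_iff_eq)

text \<open>Every other member is even, hence bisected by \<open>{x}\<close>, hence a pair through
  \<open>x\<close>. The choice \<open>j = x\<close> accounts for the singleton itself.\<close>

lemma card_le_if_singleton:
  assumes "{x} \<in> F"
  shows "card F \<le> card X"
proof -
  have "A \<in> (\<lambda>j. {x, j}) ` X" if A: "A \<in> F" for A
  proof (cases "A = {x}")
    case True
    then show ?thesis using assms sub by auto
  next
    case False
    then have "even (card A)" using odd_unique[of A "{x}"] A assms by auto
    moreover have le: "card ({x} \<inter> A) \<le> 1" by (metis card_mono finite.intros inf_le1 is_singletonI is_singleton_altdef)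
    moreover have half: "2 * card ({x} \<inter> A) = card A" using pair[of "{x}" A] False A assms by auto
    ultimately have "card ({x} \<inter> A) = 1" using card_pos[OF A] by linarith
    then have "card A = 2" using half by simp
    have "x \<in> A" using \<open>card ({x} \<inter> A) = 1\<close> by (cases "x \<in> A") auto
    with \<open>card A = 2\<close> obtain j where "A = {x, j}" by (rule card_2_obtain_other)
    then show ?thesis using A sub by auto
  qed
  then have "F \<subseteq> (\<lambda>j. {x, j}) ` X" by blast
  then show ?thesis using finX by (meson card_image_le card_mono finite_imageI le_trans)
qed

text \<open>All members but at most one are odd or have at least 4 points, so the weight bound with
  \<open>k = 2\<close> applies to them.\<close>

lemma few_pairs_card_le:
  assumes "\<And>A. A \<in> F \<Longrightarrow> card A \<noteq> 1" "card (layer 2) \<le> 1"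
  shows "12 * card F \<le> 12 + 13 * card X"
proof -
  have "real (card (F - layer 2)) \<le> petal_weight 2 * real (card X)"
  proof (rule card_le[where Z = "{}"])
    show "odd (card A) \<or> 2 * 2 \<le> card A" if A: "A \<in> F - layer 2" for A
    proof -
      have "card A > 0" "card A \<noteq> 2" using A card_pos by (auto simp: layer_def)
      then show ?thesis by presburger
    qed
  qed (use assms sub finX in \<open>auto simp: petal_weight_2\<close>)
  then have "12 * real (card (F - layer 2)) \<le> 13 * real (card X)"
    by (simp add: petal_weight_2)
  then have "12 * card (F - layer 2) \<le> 13 * card X" by linarith
  moreover have "card F = card (F - layer 2) + card (layer 2)"
    using finF by (subst card_Diff_subset) (auto simp: layer_def card_mono)
  ultimately show ?thesis using assms(2) by linarith
qed

text \<open>The constant 6 rules out an extremal family, for which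
  \<open>2 * card F + 5 \<ge> 3 * card X\<close>.\<close>

lemma few_pairs_card_le_strict:
  assumes no1: "\<And>A. A \<in> F \<Longrightarrow> card A \<noteq> 1" and few: "card (layer 2) \<le> 1" and "card X \<ge> 3"
  shows "2 * card F + 6 \<le> 3 * card X"
proof (cases "card X \<ge> 8")
  case True
  have "12 * card F \<le> 12 + 13 * card X" using few_pairs_card_le no1 few by blast
  \<comment> \<open>The linear estimate suffices from 10 points on; for 8 and 9 points it does after
    rounding \<open>card F\<close> down.\<close>
  moreover have "card X = 8 \<or> card X = 9 \<or> card X \<ge> 10" using True by linarith
  ultimately show ?thesis by auto
next
  case False
  define n where "n = card X"
  have n: "3 \<le> n" "n \<le> 7" using False assms(3) by (auto simp: n_def)
  define odds where "odds = {A\<in>F. odd (card A)}"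
  have odds: "card odds \<le> 1" using card_odd_le_1 by (simp add: odds_def)
  have "F \<subseteq> (layer 2 \<union> layer 4) \<union> (layer 6 \<union> odds)"
  proof
    fix A assume A: "A \<in> F"
    then have "card A \<le> 7" "card A > 0" using card_member_le[OF A] card_pos[OF A] n by (auto simp: n_def)
    then have "card A = 2 \<or> card A = 4 \<or> card A = 6 \<or> odd (card A)" by presburger
    then show "A \<in> (layer 2 \<union> layer 4) \<union> (layer 6 \<union> odds)" using A by (auto simp: layer_def odds_def)
  qed
  then have "card F \<le> card ((layer 2 \<union> layer 4) \<union> (layer 6 \<union> odds))"
    using finF by (intro card_mono) (auto simp: layer_def odds_def)
  also have "\<dots> \<le> (card (layer 2) + card (layer 4)) + (card (layer 6) + card odds)"
    using card_Un_le[of "layer 2" "layer 4"] card_Un_le[of "layer 6" odds]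
      card_Un_le[of "layer 2 \<union> layer 4" "layer 6 \<union> odds"] by linarith
  finally have F: "card F \<le> card (layer 2) + card (layer 4) + card (layer 6) + card odds" by simp
  have l4: "card (layer 4) = 0 \<or> 2 * (card (layer 4) + 1) \<le> n"
    using layer_card_le[of 2] by (cases "layer 4 = {}") (auto simp: n_def)
  have l6: "card (layer 6) = 0 \<or> 3 * (card (layer 6) + 1) \<le> n"
    using layer_card_le[of 3] by (cases "layer 6 = {}") (auto simp: n_def)
  show ?thesis
  proof (cases "n = 3")
    case False
    then have "4 \<le> n" using n by linarith
    then consider "n = 4" | "n = 5" | "n = 6" | "n = 7" using n by linarith
    then show ?thesis using F l4 l6 few odds unfolding n_def[symmetric] by cases auto
  next
    case n3: True
    \<comment> \<open>On three points only one set is allowed. An odd member would be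
      \<open>X\<close> itself, which meets a pair in 2 points, half of neither size.\<close>
    have "layer 2 = {} \<or> odds = {}"
    proof (rule ccontr)
      assume "\<not> ?thesis"
      then obtain A D where AD: "A \<in> F" "card A = 2" "D \<in> F" "odd (card D)"
        by (auto simp: layer_def odds_def)
      have "card D \<noteq> 1" "card D \<le> 3" using no1 AD card_member_le n3 by (auto simp: n_def)
      then have D3: "card D = 3" using AD(4) by presburger
      have "D \<subseteq> X" using AD(3) sub by blast
      then have "D = X" using D3 n3 finX by (intro card_subset_eq) (auto simp: n_def)
      then have "A \<inter> D = A" using AD sub by blast
      moreover have "A \<noteq> D" using AD D3 by auto
      ultimately show False using pair[of A D] AD D3 by auto
    qed
    then show ?thesis using F l4 l6 few odds n3 unfolding n_def[symmetric] by auto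
  qed
qed

section \<open>Families with at least two pairs\<close>

text \<open>\<open>c\<close> is the common point of the pairs, \<open>y\<close> a second point
  common to the 4-sets, and \<open>v\<close> the number of points other than \<open>c\<close> that
  form no pair with \<open>c\<close>.\<close>

lemma star:
  assumes no1: "\<forall>A\<in>F. card A \<noteq> 1" and many: "card (layer 2) \<ge> 2"
  obtains c y v where "c \<in> X" "y \<in> X" "c \<noteq> y"
    "\<forall>A\<in>layer 2. \<exists>j\<in>X - {c}. A = {c, j}"
    "\<forall>A\<in>layer 4. {c, y} \<subseteq> A"
    "\<forall>A\<in>layer 4. \<forall>B\<in>layer 4. A \<noteq> B \<longrightarrow> A \<inter> B = {c, y}"
    "2 * card (layer 4) + 2 \<le> card X"
    "card (layer 2) + v + 1 = card X"
    "20 * card others \<le> 19 * v"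
proof -
  obtain A B where AB: "A \<in> layer 2" "B \<in> layer 2" "A \<noteq> B"
    using many by (meson card_2_iff' obtain_subset_with_card_n subset_iff)
  then have ABF: "A \<in> F" "B \<in> F" "card A = 2" "card B = 2" by (auto simp: layer_def)
  then have "card (A \<inter> B) = 1" using inter_half[of A B] AB(3) by simp
  then obtain c where c: "A \<inter> B = {c}" by (metis card_1_singletonE)
  \<comment> \<open>Two pairs meet only in \<open>c\<close>, so a member avoiding \<open>c\<close>
    would give an empty triple intersection, which is half of no nonempty set.\<close>
  have cC: "c \<in> C" if C: "C \<in> F" for C
  proof (rule ccontr)
    assume nc: "c \<notin> C"
    then have "C \<noteq> A" "C \<noteq> B" "A \<inter> B \<inter> C = {}" using c by auto
    then show False using triple[of A B C] ABF AB(3) C card_pos[OF C] by auto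
  qed
  have cX: "c \<in> X" using cC[of A] ABF sub by auto
  have pairs: "\<exists>j\<in>X - {c}. C = {c, j}" if C: "C \<in> layer 2" for C
  proof -
    have CF: "C \<in> F" "card C = 2" using C by (auto simp: layer_def)
    obtain j where "j \<noteq> c" "C = {c, j}"
      using CF(2) cC[OF CF(1)] by (rule card_2_obtain_other)
    then show ?thesis using CF sub by auto
  qed
  define P where "P = {j\<in>X - {c}. {c, j} \<in> F}"
  have "layer 2 = (\<lambda>j. {c, j}) ` P"
  proof (intro equalityI subsetI)
    fix C assume "C \<in> layer 2"
    then show "C \<in> (\<lambda>j. {c, j}) ` P" using pairs[of C] by (auto simp: P_def layer_def)
  qed (auto simp: P_def layer_def)
  moreover have "inj_on (\<lambda>j. {c, j}) P" by (auto simp: inj_on_def P_def doubleton_eq_iff)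
  ultimately have cardP: "card (layer 2) = card P" by (simp add: card_image)
  define V where "V = X - {c} - P"
  have finP: "finite P" "P \<subseteq> X - {c}" using finX by (auto simp: P_def)
  have cardV: "card (layer 2) + card V + 1 = card X"
  proof -
    have "card V = card (X - {c}) - card P" unfolding V_def using finP by (intro card_Diff_subset)
    moreover have "card P \<le> card (X - {c})" using finP finX by (intro card_mono) auto
    moreover have "card X = card (X - {c}) + 1" using card.remove[OF finX cX] by simp
    ultimately show ?thesis using cardP by linarith
  qed
  have "real (card others) \<le> petal_weight 3 * real (card V)"
  proof (rule card_le[where Z = "{c}"])
    show "odd (card C) \<or> 2 * 3 \<le> card C" if C: "C \<in> others" for C
    proof -
      have "card C > 0" "card C \<noteq> 2" "card C \<noteq> 4" using C card_pos by (auto simp: others_def)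
      then show ?thesis by presburger
    qed
    show "C \<subseteq> V \<union> {c}" if C: "C \<in> others" for C
    proof -
      have CF: "C \<in> F" "card C \<noteq> 2" "card C \<noteq> 4" using C by (auto simp: others_def)
      \<comment> \<open>Otherwise the pair \<open>{c, j}\<close> lies inside \<open>C\<close>, and
        the intersection of size 2 would force \<open>C\<close> to have 4 points.\<close>
      have "j \<notin> C" if j: "j \<in> P" for j
      proof
        assume "j \<in> C"
        then have "{c, j} \<inter> C = {c, j}" using cC[OF CF(1)] by blast
        moreover have "card {c, j} = 2" "{c, j} \<in> F" using j by (auto simp: P_def)
        ultimately show False using pair[of "{c, j}" C] CF by force
      qed
      then show ?thesis using CF(1) sub by (auto simp: V_def)
    qed
    show "finite V" using finX by (simp add: V_def)
  qed (use no1 cC in \<open>auto simp: petal_weight_3 others_def\<close>)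
  then have "20 * real (card others) \<le> 19 * real (card V)" by (simp add: petal_weight_3)
  then have cardG: "20 * card others \<le> 19 * card V" by linarith
  have "card X \<ge> 2" using many cardV by linarith
  then have four: "2 * card (layer 4) + 2 \<le> card X"
    using layer_card_le[of 2] by (cases "layer 4 = {}") auto
  \<comment> \<open>Two 4-sets determine \<open>y\<close>. With a single 4-set any of its points
    besides \<open>c\<close> will do, and with none any point besides \<open>c\<close>.\<close>
  have "\<exists>y\<in>X - {c}. (\<forall>C\<in>layer 4. y \<in> C) \<and> (\<forall>C\<in>layer 4. \<forall>D\<in>layer 4. C \<noteq> D \<longrightarrow> C \<inter> D = {c, y})"
  proof (cases "\<exists>C\<in>layer 4. \<exists>D\<in>layer 4. C \<noteq> D")
    case True
    then obtain C D where CD: "C \<in> layer 4" "D \<in> layer 4" "C \<noteq> D" by blast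
    then have CDF: "C \<in> F" "D \<in> F" "card C = 4" "card D = 4" by (auto simp: layer_def)
    have "card (C \<inter> D) = 2" using inter_half[of C D] CD CDF by simp
    moreover have "c \<in> C \<inter> D" using cC CDF by blast
    ultimately obtain y where y: "y \<noteq> c" "C \<inter> D = {c, y}"
      by (rule card_2_obtain_other)
    have meet: "C' \<inter> D' = {c, y}" if "C' \<in> layer 4" "D' \<in> layer 4" "C' \<noteq> D'" for C' D'
      using layer_sunflower[OF CD(1,2) that(1,2) CD(3) that(3)] y by simp
    have "y \<in> C'" if "C' \<in> layer 4" for C'
      using meet[OF that CD(1)] meet[OF that CD(2)] CD(3) by (cases "C' = C") auto
    moreover have "y \<in> X" using y CDF(1) sub by blast
    ultimately show ?thesis using meet y by (intro bexI[of _ y]) auto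
  next
    case single: False
    show ?thesis
    proof (cases "layer 4 = {}")
      case True
      have "X - {c} \<noteq> {}" using \<open>card X \<ge> 2\<close> card.remove[OF finX cX] by fastforce
      then show ?thesis using True by blast
    next
      case False
      then obtain C where C: "C \<in> layer 4" by blast
      then have CF: "C \<in> F" "card C = 4" by (auto simp: layer_def)
      have "C - {c} \<noteq> {}"
      proof
        assume "C - {c} = {}"
        then have "C \<subseteq> {c}" by blast
        then have "card C \<le> card {c}" by (intro card_mono) auto
        then show False using CF by simp
      qed
      then obtain y where "y \<in> C" "y \<noteq> c" by blast
      then show ?thesis using single C CF sub by (intro bexI[of _ y]) auto
    qed
  qed
  then obtain y where y: "y \<in> X - {c}" "\<forall>C\<in>layer 4. y \<in> C"
    "\<forall>C\<in>layer 4. \<forall>D\<in>layer 4. C \<noteq> D \<longrightarrow> C \<inter> D = {c, y}" by (elim bexE conjE)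
  show ?thesis
  proof (rule that[OF cX _ _ _ _ y(3) four cardV])
    show "y \<in> X" "c \<noteq> y" using y(1) by auto
    show "\<forall>C\<in>layer 2. \<exists>j\<in>X - {c}. C = {c, j}" using pairs by (rule ballI)
    show "\<forall>C\<in>layer 4. {c, y} \<subseteq> C" using y(2) cC by (auto simp: layer_def)
  qed (rule cardG)
qed

lemma card_layers: "card F = card (layer 2) + card (layer 4) + card others"
proof -
  have "F = (layer 2 \<union> layer 4) \<union> others" by (auto simp: layer_def others_def)
  also have "card \<dots> = card (layer 2 \<union> layer 4) + card others"
    using finF by (intro card_Un_disjoint) (auto simp: layer_def others_def)
  also have "card (layer 2 \<union> layer 4) = card (layer 2) + card (layer 4)"
    using finF by (intro card_Un_disjoint) (auto simp: layer_def others_def)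
  finally show ?thesis by simp
qed

text \<open>A singleton member gives \<open>card F \<le> card X\<close>, which is good enough from 4
  points on; this explains the first assumption.\<close>

lemma card_le_bound:
  assumes "card X \<le> 3 \<Longrightarrow> (\<forall>A\<in>F. card A \<noteq> 1)" "card X \<ge> 2"
  shows "2 * card F + 4 \<le> 3 * card X"
proof (cases "\<forall>A\<in>F. card A \<noteq> 1")
  case False
  then obtain x where "{x} \<in> F" by (metis card_1_singletonE)
  then show ?thesis using card_le_if_singleton[of x] assms(1) False by fastforce
next
  case no1: True
  consider "card (layer 2) \<ge> 2" | "card (layer 2) \<le> 1" "card X \<ge> 3" | "card X = 2"
    using assms(2) by linarith
  then show ?thesis
  proof cases
    case 1
    show ?thesis
    proof (rule star[OF no1 1])
      fix v
      assume "2 * card (layer 4) + 2 \<le> card X" "card (layer 2) + v + 1 = card X"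
        "20 * card others \<le> 19 * v"
      then show ?thesis using card_layers by simp
    qed
  next
    case 2
    then show ?thesis using few_pairs_card_le_strict no1 by fastforce
  next
    case 3
    have "A = X" if "A \<in> F" for A
    proof -
      have "card A = 2" using that no1 card_pos[OF that] card_member_le[OF that] 3 by fastforce
      then show ?thesis using that sub finX 3 by (intro card_subset_eq) auto
    qed
    then have "F \<subseteq> {X}" by blast
    then have "card F \<le> 1" by (metis card_mono finite.intros is_singletonI is_singleton_altdef)
    then show ?thesis using 3 by simp
  qed
qed

end

section \<open>Reduction to pairs and triples, and permutations arranging a sunflower\<close>

lemma bisection_closed_mono:
  assumes "bisection_closed r F" "G \<subseteq> F"
  shows "bisection_closed r G"
  using assms unfolding bisection_closed_def by (meson order_trans)

lemma bisecting_familyI: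
  assumes "finite X" "F \<subseteq> Pow X" "{} \<notin> F" "bisection_closed r F" "r \<ge> 3"
  shows "bisecting_family X F"
proof
  have half: "\<exists>A\<in>S. 2 * card (\<Inter>S) = card A" if S: "S \<subseteq> F" "card S = 2 \<or> card S = 3" for S
  proof -
    have "card S \<in> {2..r}" using S(2) assms(5) by auto
    then have "real (card (\<Inter>S)) \<in> (\<lambda>A. real (card A) / 2) ` S"
      using assms(4) S(1) unfolding bisection_closed_def by blast
    then obtain A where A: "A \<in> S" "real (card (\<Inter>S)) = real (card A) / 2" by blast
    then have "2 * card (\<Inter>S) = card A" by linarith
    then show ?thesis using A(1) by blast
  qed
  show "2 * card (A \<inter> B) \<in> {card A, card B}" if "A \<in> F" "B \<in> F" "A \<noteq> B" for A B
    using half[of "{A, B}"] that by auto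
  show "2 * card (A \<inter> B \<inter> C) \<in> {card A, card B, card C}"
    if "A \<in> F" "B \<in> F" "C \<in> F" "A \<noteq> B" "A \<noteq> C" "B \<noteq> C" for A B C
    using half[of "{A, B, C}"] that by (auto simp: Int_assoc)
qed fact+

text \<open>The complements of \<open>S\<close> and of its image have equal size, so any bijection
  between them completes \<open>f\<close>.\<close>

lemma inj_on_extends_permutes:
  assumes "finite X" "S \<subseteq> X" "inj_on f S" "f ` S \<subseteq> X"
  obtains \<sigma> where "\<sigma> permutes X" "\<And>x. x \<in> S \<Longrightarrow> \<sigma> x = f x"
proof -
  have fin: "finite S" using assms finite_subset by blast
  have "card (X - S) = card (X - f ` S)"
    using assms fin by (simp add: card_Diff_subset card_image)
  then obtain g where g: "bij_betw g (X - S) (X - f ` S)"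
    using assms(1) by (metis finite_Diff finite_same_card_bij)
  define \<sigma> where "\<sigma> x = (if x \<in> S then f x else if x \<in> X then g x else x)" for x
  have "bij_betw \<sigma> S (f ` S)"
    using assms(3) by (simp add: bij_betw_def inj_on_def \<sigma>_def)
  moreover have "bij_betw \<sigma> (X - S) (X - f ` S)"
    using g bij_betw_cong[of "X - S" \<sigma> g "X - f ` S"] by (simp add: \<sigma>_def)
  ultimately have "bij_betw \<sigma> (S \<union> (X - S)) (f ` S \<union> (X - f ` S))"
    by (intro bij_betw_combine) auto
  moreover have "S \<union> (X - S) = X" "f ` S \<union> (X - f ` S) = X" using assms by auto
  ultimately have "bij_betw \<sigma> X X" by simp
  then have "\<sigma> permutes X"
    using assms(2) by (intro bij_imp_permutes) (auto simp: \<sigma>_def)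
  then show ?thesis using that[of \<sigma>] by (simp add: \<sigma>_def)
qed

text \<open>The petals are numbered from 1 by \<open>h\<close>, and the two points of petal
  \<open>k\<close> receive the labels \<open>2 * k + 1\<close> and \<open>2 * k + 2\<close>. This
  partial labelling extends to a permutation.\<close>

lemma arrange_sunflower:
  fixes n :: nat
  assumes "c \<in> {1..n}" "y \<in> {1..n}" "c \<noteq> y" "D \<subseteq> Pow {1..n}"
    and c4: "\<forall>A\<in>D. card A = 4" and cy: "\<forall>A\<in>D. {c, y} \<subseteq> A"
    and meet: "\<forall>A\<in>D. \<forall>B\<in>D. A \<noteq> B \<longrightarrow> A \<inter> B = {c, y}"
    and "2 * card D + 2 \<le> n"
  obtains \<sigma> where "\<sigma> permutes {1..n}" "\<sigma> c = 1" "\<sigma> y = 2"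
    "\<forall>A\<in>D. \<exists>k. 1 \<le> k \<and> k \<le> (n - 2) div 2 \<and> \<sigma> ` A = {1, 2, 2 * k + 1, 2 * k + 2}"
proof -
  note c4 = bspec[OF c4] and cy = bspec[OF cy]
  have finD: "finite D" using assms(4) by (meson finite_Pow_iff finite_atLeastAtMost finite_subset)
  obtain h where h: "bij_betw h D {1..card D}"
    using finD by (metis card_atLeastAtMost diff_Suc_1 finite_atLeastAtMost finite_same_card_bij)
  have "\<exists>p q. A - {c, y} = {p, q} \<and> p \<noteq> q" if "A \<in> D" for A
  proof -
    have "card (A - {c, y}) = card A - card {c, y}" using cy[OF that] by (intro card_Diff_subset) auto
    then have "card (A - {c, y}) = 2" using c4[OF that] assms(3) by simp
    then show ?thesis by (auto simp: card_2_iff)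
  qed
  then obtain p q where pq: "\<And>A. A \<in> D \<Longrightarrow> A - {c, y} = {p A, q A}" "\<And>A. A \<in> D \<Longrightarrow> p A \<noteq> q A"
    by metis
  have uniq: "A = B" if "A \<in> D" "B \<in> D" "x \<in> A" "x \<in> B" "x \<noteq> c" "x \<noteq> y" for A B x
    using meet that by blast
  \<comment> \<open>The petals are disjoint, so a point outside the kernel determines its
    set.\<close>
  define own where "own x = (THE A. A \<in> D \<and> x \<in> A)" for x
  have own: "own x = A" if "A \<in> D" "x \<in> A" "x \<noteq> c" "x \<noteq> y" for A x
    unfolding own_def using that uniq by (intro the_equality) auto
  define f where "f x = (if x = c then 1 else if x = y then 2 else
      2 * h (own x) + (if x = p (own x) then 1 else 2))" for x
  have p: "p A \<in> A" "p A \<noteq> c" "p A \<noteq> y" and q: "q A \<in> A" "q A \<noteq> c" "q A \<noteq> y" if "A \<in> D" for A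
    using pq(1)[OF that] by auto
  have fp: "f (p A) = 2 * h A + 1" if "A \<in> D" for A
    using own[OF that p(1)[OF that] p(2,3)[OF that]] p[OF that] by (simp add: f_def)
  have fq: "f (q A) = 2 * h A + 2" if "A \<in> D" for A
    using own[OF that q(1)[OF that] q(2,3)[OF that]] q[OF that] pq(2)[OF that] by (simp add: f_def)
  have fc: "f c = 1" "f y = 2" using assms(3) by (auto simp: f_def)
  have hk: "1 \<le> h A" "h A \<le> card D" if "A \<in> D" for A
    using bij_betw_apply[OF h that] by auto
  define S where "S = {c, y} \<union> \<Union>D"
  have split: "(x = c \<and> f x = 1) \<or> (x = y \<and> f x = 2) \<or> (\<exists>A\<in>D. x = p A \<and> f x = 2 * h A + 1)
      \<or> (\<exists>A\<in>D. x = q A \<and> f x = 2 * h A + 2)" if x: "x \<in> S" for x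
  proof (cases "x = c \<or> x = y")
    case True
    then show ?thesis using fc by blast
  next
    case False
    then obtain A where A: "A \<in> D" "x \<in> A" using x by (auto simp: S_def)
    then have "x = p A \<or> x = q A" using pq(1)[OF A(1)] False by blast
    then show ?thesis using A fp fq by blast
  qed
  \<comment> \<open>An explicit left inverse of \<open>f\<close>: the petal number is
    \<open>m div 2\<close> for an odd label and \<open>m div 2 - 1\<close> for an even one.\<close>
  define g where "g m = (if m = 1 then c else if m = 2 then y else
      if odd m then p (inv_into D h (m div 2)) else q (inv_into D h (m div 2 - 1)))" for m
  have hinv: "inv_into D h (h A) = A" if "A \<in> D" for A
    using h that by (simp add: bij_betw_def)
  have "inj_on f S"
  proof (rule inj_on_inverseI[where g = g])
    fix x assume "x \<in> S"
    then consider "x = c" | "x = y" | A where "A \<in> D" "x = p A" | A where "A \<in> D" "x = q A"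
      using split by blast
    then show "g (f x) = x"
    proof cases
      case 3
      then show ?thesis using hk(1)[OF 3(1)] fp[OF 3(1)] hinv[OF 3(1)] by (simp add: g_def)
    next
      case 4
      then show ?thesis using hk(1)[OF 4(1)] fq[OF 4(1)] hinv[OF 4(1)] by (simp add: g_def)
    qed (use fc assms(3) in \<open>auto simp: g_def\<close>)
  qed
  moreover have "f ` S \<subseteq> {1..n}"
  proof
    fix z assume "z \<in> f ` S"
    then obtain x where x: "x \<in> S" "z = f x" by blast
    have "2 \<le> n" "\<And>A. A \<in> D \<Longrightarrow> 2 * h A + 2 \<le> n" using assms(8) hk(2) by fastforce+
    then show "z \<in> {1..n}" using split[OF x(1)] x(2) by fastforce
  qed
  moreover have "S \<subseteq> {1..n}" using assms(1,2,4) by (auto simp: S_def)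
  ultimately obtain \<sigma> where \<sigma>: "\<sigma> permutes {1..n}" "\<And>x. x \<in> S \<Longrightarrow> \<sigma> x = f x"
    using inj_on_extends_permutes[of "{1..n}" S f] by blast
  show ?thesis
  proof (rule that[OF \<sigma>(1)])
    show "\<sigma> c = 1" "\<sigma> y = 2" using \<sigma>(2) fc by (auto simp: S_def)
  next
    show "\<forall>A\<in>D. \<exists>k. 1 \<le> k \<and> k \<le> (n - 2) div 2 \<and> \<sigma> ` A = {1, 2, 2 * k + 1, 2 * k + 2}"
    proof
      fix A assume A: "A \<in> D"
      have "A = {c, y, p A, q A}" using pq(1)[OF A] cy[OF A] by blast
      then have "\<sigma> ` A = \<sigma> ` {c, y, p A, q A}" by (rule arg_cong)
      also have "\<dots> = {\<sigma> c, \<sigma> y, \<sigma> (p A), \<sigma> (q A)}" by simp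
      also have "\<dots> = {1, 2, 2 * h A + 1, 2 * h A + 2}"
      proof -
        have "c \<in> S" "y \<in> S" "p A \<in> S" "q A \<in> S"
          using p(1)[OF A] q(1)[OF A] A by (auto simp: S_def)
        then show ?thesis by (simp add: \<sigma>(2) fc fp[OF A] fq[OF A])
      qed
      finally have "\<sigma> ` A = {1, 2, 2 * h A + 1, 2 * h A + 2}" .
      moreover have "h A \<le> (n - 2) div 2" using hk(2)[OF A] assms(8) by linarith
      ultimately show "\<exists>k. 1 \<le> k \<and> k \<le> (n - 2) div 2 \<and> \<sigma> ` A = {1, 2, 2 * k + 1, 2 * k + 2}"
        using hk(1)[OF A] by blast
    qed
  qed
qed

section \<open>The extremal family\<close>

lemma F_max_subset: "n \<ge> 2 \<Longrightarrow> F_max n \<subseteq> Pow {1..n}"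
  unfolding F_max_def by auto

lemma card_F_max:
  assumes "n \<ge> 2"
  shows "card (F_max n) + 2 = 3 * n div 2"
proof -
  define P where "P = (\<lambda>j. {1, j}) ` {2..n}"
  define Q where "Q = (\<lambda>k. {1, 2, 2 * k + 1, 2 * k + 2}) ` {1..(n - 2) div 2}"
  have "F_max n = P \<union> Q" unfolding F_max_def P_def Q_def by auto
  moreover have "P \<inter> Q = {}"
  proof -
    have "card A = 2" if "A \<in> P" for A using that by (auto simp: P_def)
    moreover have "card A = 4" if "A \<in> Q" for A using that by (auto simp: Q_def)
    ultimately show ?thesis by fastforce
  qed
  moreover have "finite P" "finite Q" by (auto simp: P_def Q_def)
  moreover have "card P = n - 1"
  proof -
    have "inj_on (\<lambda>j::nat. {1, j}) {2..n}" by (auto simp: inj_on_def doubleton_eq_iff)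
    then show ?thesis by (simp add: P_def card_image)
  qed
  moreover have "card Q = (n - 2) div 2"
  proof -
    have "inj_on (\<lambda>k::nat. {1, 2, 2 * k + 1, 2 * k + 2}) {1..(n - 2) div 2}"
    proof (rule inj_onI)
      fix k l :: nat
      assume kl: "k \<in> {1..(n - 2) div 2}" "l \<in> {1..(n - 2) div 2}"
        "{1, 2, 2 * k + 1, 2 * k + 2} = {1, 2, 2 * l + 1, 2 * l + 2}"
      then have "2 * k + 1 \<in> {1, 2, 2 * l + 1, 2 * l + 2}" by blast
      then show "k = l" using kl(1) by auto
    qed
    then show ?thesis by (simp add: Q_def card_image)
  qed
  ultimately have "card (F_max n) = (n - 1) + (n - 2) div 2" by (simp add: card_Un_disjoint)
  moreover obtain m where "n = m + 2" using assms by (metis add.commute le_Suc_ex)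
  ultimately show ?thesis by simp
qed

text \<open>If a pair occurs in \<open>S\<close>, the intersection is \<open>{1}\<close>, half of
  that pair, or the whole pair, which is half of another member; that member has 4 points because
  distinct pairs share only 1. If only 4-sets occur, it is \<open>{1, 2}\<close>.\<close>

lemma bisection_closed_F_max: "bisection_closed r (F_max n)"
  unfolding bisection_closed_def
proof (intro ballI allI impI)
  fix t and S :: "nat set set"
  assume t: "t \<in> {2..r}" and S: "S \<subseteq> F_max n" "card S = t"
  from t S have "card S \<ge> 2" by simp
  then obtain A B where AB: "A \<in> S" "B \<in> S" "A \<noteq> B"
    by (meson card_2_iff' obtain_subset_with_card_n subset_iff)
  have one: "1 \<in> U" if "U \<in> S" for U using that S by (auto simp: F_max_def)
  show "real (card (\<Inter>S)) \<in> (\<lambda>A. real (card A) / 2) ` S"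
  proof (cases "\<exists>j\<ge>2. {1, j} \<in> S")
    case True
    then obtain j where j: "j \<ge> 2" "{1, j} \<in> S" by blast
    show ?thesis
    proof (cases "j \<in> \<Inter>S")
      case False
      then have "\<Inter>S = {1}" using one j(2) by auto
      then show ?thesis using j by (intro image_eqI[where x = "{1, j}"]) auto
    next
      case jS: True
      then have meet: "\<Inter>S = {1, j}" using one j(2) by auto
      obtain U where U: "U \<in> S" "U \<noteq> {1, j}" using AB by metis
      have "j \<in> U" using jS U by blast
      moreover have "U \<in> F_max n" using U S by blast
      ultimately obtain k where "1 \<le> k" "U = {1, 2, 2 * k + 1, 2 * k + 2}"
        using U(2) j(1) by (auto simp: F_max_def)
      then have "card U = 4" by auto
      then show ?thesis using meet j U by (intro image_eqI[where x = U]) auto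
    qed
  next
    case False
    have four: "\<exists>k\<ge>1. U = {1, 2, 2 * k + 1, 2 * k + 2}" if "U \<in> S" for U
      using that S False by (auto simp: F_max_def)
    obtain k l where k: "k \<ge> 1" "A = {1, 2, 2 * k + 1, 2 * k + 2}"
      and l: "l \<ge> 1" "B = {1, 2, 2 * l + 1, 2 * l + 2}"
      using four[OF AB(1)] four[OF AB(2)] by blast
    have "k \<noteq> l" using AB(3) k l by auto
    then have "A \<inter> B \<subseteq> {1, 2}" using k l by (auto; presburger)
    moreover have "{1, 2} \<subseteq> U" if "U \<in> S" for U using four[OF that] by auto
    ultimately have "\<Inter>S = {1, 2}" using AB by blast
    moreover have "card A = 4" using k by auto
    ultimately show ?thesis using AB(1) by (intro image_eqI[where x = A]) auto
  qed
qed

text \<open>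
  Placing the centre at \<open>1\<close> and the kernel of the 4-sets at \<open>{1, 2}\<close> sends all pairs and 4-sets
  into \<open>F_max\<close>.
\<close>

lemma star_arrange:
  assumes "bisecting_family {1..n} F" and no1: "\<forall>A\<in>F. card A \<noteq> 1"
    and many: "card (bisecting_family.layer F 2) \<ge> 2"
  obtains \<sigma> m v where "\<sigma> permutes {1..n}"
    "\<forall>A\<in>F - bisecting_family.others F. \<sigma> ` A \<in> F_max n"
    "2 * m + 2 \<le> n" "card F + v + 1 = n + m + card (bisecting_family.others F)"
    "20 * card (bisecting_family.others F) \<le> 19 * v"
proof -
  interpret bisecting_family "{1..n}" F by fact
  obtain c y v where cy: "c \<in> {1..n}" "y \<in> {1..n}" "c \<noteq> y"
    and l2: "\<forall>A\<in>layer 2. \<exists>j\<in>{1..n} - {c}. A = {c, j}"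
    and l4: "\<forall>A\<in>layer 4. {c, y} \<subseteq> A"
      "\<forall>A\<in>layer 4. \<forall>B\<in>layer 4. A \<noteq> B \<longrightarrow> A \<inter> B = {c, y}"
    and sizes: "2 * card (layer 4) + 2 \<le> card {1..n}" "card (layer 2) + v + 1 = card {1..n}"
      "20 * card others \<le> 19 * v"
    by (rule star[OF no1 many])
  have l4_sub: "layer 4 \<subseteq> Pow {1..n}" using sub by (auto simp: layer_def)
  have l4_card: "\<forall>A\<in>layer 4. card A = 4" by (simp add: layer_def)
  have four_le: "2 * card (layer 4) + 2 \<le> n" using sizes(1) by simp
  obtain \<sigma> where \<sigma>: "\<sigma> permutes {1..n}" "\<sigma> c = 1" "\<sigma> y = 2"
    "\<forall>A\<in>layer 4. \<exists>k. 1 \<le> k \<and> k \<le> (n - 2) div 2 \<and> \<sigma> ` A = {1, 2, 2 * k + 1, 2 * k + 2}"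
    by (rule arrange_sunflower[OF cy l4_sub l4_card l4 four_le])
  show ?thesis
  \<comment> \<open>The number \<open>m\<close> is instantiated with the number of 4-sets.\<close>
  proof (rule that[OF \<sigma>(1) _ four_le], rule ballI)
    fix A assume "A \<in> F - others"
    then consider "A \<in> layer 2" | "A \<in> layer 4" by (auto simp: others_def layer_def)
    then show "\<sigma> ` A \<in> F_max n"
    proof cases
      case 1
      then obtain j where j: "j \<in> {1..n}" "j \<noteq> c" "A = {c, j}" using l2 by blast
      have "\<sigma> j \<in> {1..n}" using \<sigma>(1) j(1) by (simp only: permutes_in_image)
      moreover have "\<sigma> j \<noteq> 1" using \<sigma>(1,2) j(2) by (metis permutes_inj injD)
      ultimately have "2 \<le> \<sigma> j \<and> \<sigma> j \<le> n" by auto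
      moreover have "\<sigma> ` A = {1, \<sigma> j}" using j \<sigma>(2) by simp
      ultimately show ?thesis unfolding F_max_def by blast
    next
      case 2
      then show ?thesis using bspec[OF \<sigma>(4) 2] unfolding F_max_def by blast
    qed
  next
    show "card F + v + 1 = n + card (layer 4) + card others"
      using card_layers sizes(2) by simp
  qed (rule sizes)
qed

section \<open>Bound, uniqueness and robustness for closed families\<close>

lemma family_image_eq: "family_image \<sigma> F = (`) \<sigma> ` F"
  by (auto simp: family_image_def)

text \<open>A permutation preserves the number of members, so the inclusion is one between finite
  families of equal size.\<close>

lemma F_max_eq_if_family_image_subset:
  assumes "n \<ge> 2" "\<sigma> permutes {1..n}" "family_image \<sigma> F \<subseteq> F_max n" "card F + 2 = 3 * n div 2"
  shows "F_max n = family_image \<sigma> F"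
proof -
  have "inj ((`) \<sigma>)"
    using permutes_inj[OF assms(2)] by (intro injI) (simp add: inj_image_eq_iff)
  then have "card (family_image \<sigma> F) = card F"
    unfolding family_image_eq by (metis card_image inj_on_subset subset_UNIV)
  moreover have "finite (F_max n)"
    using F_max_subset[OF assms(1)] finite_subset by blast
  ultimately show ?thesis
    using assms(1,3,4) card_F_max[of n] by (metis add_right_cancel card_subset_eq)
qed

lemma bisection_closed_card_le:
  assumes "r \<ge> 3" "n \<ge> 2" "F \<subseteq> Pow {1..n}" "bisection_closed r F" "{} \<notin> F"
    "n \<le> 3 \<longrightarrow> (\<forall>A\<in>F. card A \<noteq> 1)"
  shows "card F + 2 \<le> 3 * n div 2"
proof -
  interpret bisecting_family "{1..n}" F
    using bisecting_familyI[of "{1..n}" F r] assms by simp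
  have "2 * card F + 4 \<le> 3 * n" using card_le_bound assms by simp
  then show ?thesis by presburger
qed

text \<open>Singletons and a lack of pairs make the family too small. In the star case equality
  forces \<open>v \<le> card others\<close>, which together with
  \<open>20 * card others \<le> 19 * v\<close> leaves no other sets.\<close>

lemma bisection_closed_extremal:
  assumes "r \<ge> 3" "n \<ge> 2" "F \<subseteq> Pow {1..n}" "bisection_closed r F" "{} \<notin> F"
    and no1: "n \<le> 5 \<longrightarrow> (\<forall>A\<in>F. card A \<noteq> 1)" and eq: "card F + 2 = 3 * n div 2"
  shows "\<exists>\<sigma>. \<sigma> permutes {1..n} \<and> F_max n = family_image \<sigma> F"
proof -
  interpret bisecting_family "{1..n}" F
    using bisecting_familyI[of "{1..n}" F r] assms by simp
  have eq': "2 * card F + 5 \<ge> 3 * n" using eq by presburger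
  have no1: "\<forall>A\<in>F. card A \<noteq> 1"
  proof (rule ballI, rule notI)
    fix A assume A: "A \<in> F"
    assume "card A = 1"
    then obtain x where "{x} \<in> F" using A by (metis card_1_singletonE)
    then have "card F \<le> n" using card_le_if_singleton[of x] by simp
    moreover have "n \<ge> 6" using no1 A \<open>card A = 1\<close> by force
    ultimately show False using eq' by linarith
  qed
  consider "card (layer 2) \<ge> 2" | "card (layer 2) \<le> 1" "n \<ge> 3" | "n = 2"
    using assms(2) by linarith
  then show ?thesis
  proof cases
    case 1
    obtain \<sigma> m v where \<sigma>: "\<sigma> permutes {1..n}"
      "\<forall>A\<in>F - others. \<sigma> ` A \<in> F_max n"
      and le: "2 * m + 2 \<le> n" "card F + v + 1 = n + m + card others" "20 * card others \<le> 19 * v"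
      by (rule star_arrange[OF bisecting_family_axioms no1 1])
    have "m + 2 + n \<le> 3 * n div 2 + 1" using le(1) by presburger
    then have "v \<le> card others" using le(2) eq by linarith
    then have "card others = 0" using le(3) by linarith
    then have "others = {}" using finF by (simp add: others_def)
    then have "family_image \<sigma> F \<subseteq> F_max n" using \<sigma>(2) by (auto simp: family_image_eq)
    then show ?thesis using F_max_eq_if_family_image_subset[OF assms(2) \<sigma>(1) _ eq] \<sigma>(1) by blast
  next
    case 2
    then have "2 * card F + 6 \<le> 3 * card {1..n}"
      using no1 by (intro few_pairs_card_le_strict) auto
    then show ?thesis using eq' by simp
  next
    case 3
    have "A = {1, 2}" if A: "A \<in> F" for A
    proof (rule card_subset_eq)
      show "A \<subseteq> {1, 2}" using A sub 3 by (auto simp: subset_iff) force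
      have "card A \<le> 2" using card_member_le[OF A] 3 by simp
      then show "card A = card {1::nat, 2}" using no1 A card_pos[OF A] by force
    qed simp
    then have "family_image id F \<subseteq> F_max n" using 3 by (auto simp: family_image_eq F_max_def)
    then show ?thesis
      using F_max_eq_if_family_image_subset[OF assms(2) permutes_id _ eq] permutes_id by blast
  qed
qed

text \<open>After removal of a possible empty set the star count applies. Its defect is at least
  \<open>v - card others\<close>, hence at least a nineteenth of \<open>card others\<close>.\<close>

lemma bisection_closed_robust:
  fixes \<epsilon> :: real
  assumes "r \<ge> 3" "n \<ge> 2" "F \<subseteq> Pow {1..n}" "bisection_closed r F" "n = 2 \<longrightarrow> {} \<notin> F"
    and \<epsilon>: "0 < \<epsilon>" "\<epsilon> < 0.1" and large: "real (card F) \<ge> (3 / 2 - \<epsilon>) * real n"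
  shows "\<exists>\<sigma>. \<sigma> permutes {1..n} \<and> real (card (family_image \<sigma> F - F_max n)) < 21 * \<epsilon> * real n"
proof -
  define E where "E = F - {{}}"
  have closedE: "bisection_closed r E" using bisection_closed_mono[OF assms(4)] by (auto simp: E_def)
  interpret E: bisecting_family "{1..n}" E
    using assms(1,3) closedE by (intro bisecting_familyI[of _ _ r]) (auto simp: E_def)
  have FE: "card F \<le> card E + 1" "F \<subseteq> insert {} E"
    using E.finF by (auto simp: E_def card_Diff_singleton_if)
  have FE2: "card F = card E" if "n = 2" using that assms(5) by (simp add: E_def)
  have "\<epsilon> * real n \<le> 0.1 * real n" using \<epsilon> by (intro mult_right_mono) auto
  then have "1.4 * real n \<le> (3 / 2 - \<epsilon>) * real n" by (simp add: algebra_simps)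
  then have "1.4 * real n \<le> real (card F)" using large by linarith
  \<comment> \<open>This excludes singletons, since \<open>n + 1 < 1.4 * n\<close> for
    \<open>n \<ge> 3\<close>; for \<open>n = 2\<close> no empty set has been removed and
    \<open>n\<close> itself is too small.\<close>
  then have large': "14 * n \<le> 10 * card F" by linarith
  have no1: "\<forall>A\<in>E. card A \<noteq> 1"
  proof (rule ballI, rule notI)
    fix A assume A: "A \<in> E"
    assume "card A = 1"
    then obtain x where "{x} \<in> E" using A by (metis card_1_singletonE)
    then have "card E \<le> n" using E.card_le_if_singleton[of x] by simp
    then show False using large' FE(1) FE2 assms(2) by (cases "n = 2") auto
  qed
  have many: "card (E.layer 2) \<ge> 2"
  proof (rule ccontr)
    assume "\<not> ?thesis"
    then have few: "12 * card E \<le> 12 + 13 * n"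
      using E.few_pairs_card_le no1 by simp
    \<comment> \<open>The estimate for few pairs contradicts \<open>large'\<close> for large
      \<open>n\<close>; this general bound covers the small values.\<close>
    have "2 * card E + 4 \<le> 3 * n" using E.card_le_bound no1 assms(2) by simp
    then show False using few large' FE(1) FE2 assms(2) by (cases "n = 2") auto
  qed
  obtain \<sigma> m v where \<sigma>: "\<sigma> permutes {1..n}"
    "\<forall>A\<in>E - E.others. \<sigma> ` A \<in> F_max n"
    and le: "2 * m + 2 \<le> n" "card E + v + 1 = n + m + card E.others" "20 * card E.others \<le> 19 * v"
    by (rule star_arrange[OF E.bisecting_family_axioms no1 many])
  have "family_image \<sigma> F - F_max n \<subseteq> insert {} ((`) \<sigma> ` E.others)"
    using \<sigma>(2) FE(2) by (auto simp: family_image_eq)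
  moreover have "finite E.others" using E.finF by (simp add: E.others_def)
  ultimately have "card (family_image \<sigma> F - F_max n) \<le> card (insert {} ((`) \<sigma> ` E.others))"
    by (intro card_mono) auto
  also have "\<dots> \<le> card ((`) \<sigma> ` E.others) + 1"
    using \<open>finite E.others\<close> by (simp add: card_insert_if)
  also have "card ((`) \<sigma> ` E.others) \<le> card E.others"
    using \<open>finite E.others\<close> by (rule card_image_le)
  finally have d: "real (card (family_image \<sigma> F - F_max n)) \<le> real (card E.others) + 1" by simp
  define e where "e = \<epsilon> * real n"
  have "e > 0" using \<epsilon> assms(2) by (simp add: e_def)
  have "real (card F) \<ge> 3 / 2 * real n - e" using large by (simp add: e_def algebra_simps)
  then have "3 / 2 * real n - e \<le> real n + real m - real v + real (card E.others)"
    using le(2) FE(1) by linarith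
  moreover have "2 * real m + 2 \<le> real n" using le(1) by linarith
  moreover have "20 * real (card E.others) \<le> 19 * real v" using le(3) by linarith
  \<comment> \<open>The inequalities give \<open>v - card others \<le> e - 1\<close>, hence
    \<open>card others \<le> 19 * e - 19\<close>. The added 1 stands for the empty set.\<close>
  ultimately have "real (card E.others) + 1 < 21 * e" using \<open>e > 0\<close> by linarith
  then show ?thesis using d \<sigma>(1) by (intro exI[of _ \<sigma>]) (simp add: e_def mult.assoc)
qed

lemma floor_three_halves: "\<lfloor>3 * real n / 2\<rfloor> = int (3 * n div 2)"
  using floor_divide_of_nat_eq[of "3 * n" 2, where 'a = real] by simp

text \<open>The conditions on the empty set and on singletons exclude the degenerate families of
  \<open>bisection_closed_insert_empty\<close> and \<open>bisection_closed_star_with_centre\<close>.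
  In the robust part an empty set costs only one member, which is too much only for
  \<open>n = 2\<close>.\<close>

theorem theorem1p5:
  shows
    "(\<forall>r\<ge>3. \<forall>n\<ge>2. \<forall>F \<subseteq> Pow {1..n}.
        bisection_closed r F \<and> {} \<notin> F \<and> (n \<le> 3 \<longrightarrow> (\<forall>A\<in>F. card A \<noteq> 1)) \<longrightarrow>
        int (card F) \<le> \<lfloor>3 * real n / 2\<rfloor> - 2) \<and>
     (\<forall>r\<ge>3. \<forall>n\<ge>2.
        F_max n \<subseteq> Pow {1..n} \<and> bisection_closed r (F_max n) \<and>
        int (card (F_max n)) = \<lfloor>3 * real n / 2\<rfloor> - 2) \<and>
     (\<forall>r\<ge>3. \<forall>n\<ge>2. \<forall>F \<subseteq> Pow {1..n}.
        bisection_closed r F \<and> {} \<notin> F \<and> (n \<le> 5 \<longrightarrow> (\<forall>A\<in>F. card A \<noteq> 1)) \<and>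
        int (card F) = \<lfloor>3 * real n / 2\<rfloor> - 2 \<longrightarrow>
        (\<exists>\<sigma>. \<sigma> permutes {1..n} \<and> F_max n = family_image \<sigma> F)) \<and>
     (\<exists>C::real. C > 0 \<and>
        (\<forall>r\<ge>3. \<forall>n\<ge>2. \<forall>F \<subseteq> Pow {1..n}. \<forall>\<epsilon>::real.
           bisection_closed r F \<and> (n = 2 \<longrightarrow> {} \<notin> F) \<and>
           0 < \<epsilon> \<and> \<epsilon> < 0.1 \<and> real (card F) \<ge> (3 / 2 - \<epsilon>) * real n \<longrightarrow>
           (\<exists>\<sigma>. \<sigma> permutes {1..n} \<and>
              real (card (family_image \<sigma> F - F_max n)) < C * \<epsilon> * real n)))"
proof (intro conjI)
  show "\<forall>r\<ge>3. \<forall>n\<ge>2. \<forall>F \<subseteq> Pow {1..n}.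
        bisection_closed r F \<and> {} \<notin> F \<and> (n \<le> 3 \<longrightarrow> (\<forall>A\<in>F. card A \<noteq> 1)) \<longrightarrow>
        int (card F) \<le> \<lfloor>3 * real n / 2\<rfloor> - 2"
  proof (intro allI impI, elim conjE)
    fix r n :: nat and F :: "nat set set"
    assume "r \<ge> 3" "n \<ge> 2" "F \<subseteq> Pow {1..n}" "bisection_closed r F" "{} \<notin> F"
      "n \<le> 3 \<longrightarrow> (\<forall>A\<in>F. card A \<noteq> 1)"
    then have "card F + 2 \<le> 3 * n div 2" by (rule bisection_closed_card_le)
    then show "int (card F) \<le> \<lfloor>3 * real n / 2\<rfloor> - 2" unfolding floor_three_halves by linarith
  qed
next
  show "\<forall>r\<ge>3. \<forall>n\<ge>2. F_max n \<subseteq> Pow {1..n} \<and> bisection_closed r (F_max n) \<and>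
        int (card (F_max n)) = \<lfloor>3 * real n / 2\<rfloor> - 2"
  proof (intro allI impI conjI)
    fix r n :: nat assume "n \<ge> 2"
    then show "int (card (F_max n)) = \<lfloor>3 * real n / 2\<rfloor> - 2"
      using card_F_max[of n] unfolding floor_three_halves by linarith
  qed (use F_max_subset bisection_closed_F_max in blast)+
next
  show "\<forall>r\<ge>3. \<forall>n\<ge>2. \<forall>F \<subseteq> Pow {1..n}.
        bisection_closed r F \<and> {} \<notin> F \<and> (n \<le> 5 \<longrightarrow> (\<forall>A\<in>F. card A \<noteq> 1)) \<and>
        int (card F) = \<lfloor>3 * real n / 2\<rfloor> - 2 \<longrightarrow>
        (\<exists>\<sigma>. \<sigma> permutes {1..n} \<and> F_max n = family_image \<sigma> F)"
  proof (intro allI impI, elim conjE)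
    fix r n :: nat and F :: "nat set set"
    assume *: "r \<ge> 3" "n \<ge> 2" "F \<subseteq> Pow {1..n}" "bisection_closed r F" "{} \<notin> F"
      "n \<le> 5 \<longrightarrow> (\<forall>A\<in>F. card A \<noteq> 1)"
    assume "int (card F) = \<lfloor>3 * real n / 2\<rfloor> - 2"
    then have "card F + 2 = 3 * n div 2" unfolding floor_three_halves by linarith
    with * show "\<exists>\<sigma>. \<sigma> permutes {1..n} \<and> F_max n = family_image \<sigma> F"
      by (rule bisection_closed_extremal)
  qed
next
  show "\<exists>C::real. C > 0 \<and>
        (\<forall>r\<ge>3. \<forall>n\<ge>2. \<forall>F \<subseteq> Pow {1..n}. \<forall>\<epsilon>::real.
           bisection_closed r F \<and> (n = 2 \<longrightarrow> {} \<notin> F) \<and>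
           0 < \<epsilon> \<and> \<epsilon> < 0.1 \<and> real (card F) \<ge> (3 / 2 - \<epsilon>) * real n \<longrightarrow>
           (\<exists>\<sigma>. \<sigma> permutes {1..n} \<and>
              real (card (family_image \<sigma> F - F_max n)) < C * \<epsilon> * real n))"
  proof (intro exI[of _ 21] conjI allI impI, simp, elim conjE)
    fix r n :: nat and F :: "nat set set" and \<epsilon> :: real
    assume "r \<ge> 3" "n \<ge> 2" "F \<subseteq> Pow {1..n}" "bisection_closed r F" "n = 2 \<longrightarrow> {} \<notin> F"
      "0 < \<epsilon>" "\<epsilon> < 0.1" "real (card F) \<ge> (3 / 2 - \<epsilon>) * real n"
    then show "\<exists>\<sigma>. \<sigma> permutes {1..n} \<and>
        real (card (family_image \<sigma> F - F_max n)) < 21 * \<epsilon> * real n"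
      by (rule bisection_closed_robust)
  qed
qed

end
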